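(* Let $\mathbb T^\omega=\mathbb T\times\mathbb T\times\cdots$ be the product of countably infinitely many copies of the one-dimensional torus $\mathbb T=\mathbb R/\mathbb Z$, regarded as an abelian group under coordinatewise addition. Let $\rho$ be a quasimetric on $\mathbb T^\omega$ that is bounded (i.e. $\sup_{x,y\in\mathbb T^\omega}\rho(x,y)<\infty$) and translation invariant (i.e. $\rho(x+z,y+z)=\rho(x,y)$ for all $x,y,z\in\mathbb T^\omega$). Then there does not exist a measure $\mu$, defined on the $\sigma$-algebra generated by $\rho$, such that $(\mathbb T^\omega,\rho,\mu)$ is homogeneous in the Coifman--Weiss sense.
   Context: Quasimetric: a mapping $\rho\colon X\times X\to[0,\infty)$ on a nonempty set $X$ such that $\rho(x,y)=0$ if and only if $x=y$; $\rho(x,y)=\rho(y,x)$; and there is a constant $K\in[1,\infty)$ with $\rho(x,y)\le K(\rho(x,z)+\rho(z,y))$ for all $x,y,z\in X$. No relation between $\rho$ and the product topology of $\mathbb T^\omega$ is assumed. Balls and topology: $B_\rho(x,r)=\{y\in X:\rho(x,y)<r\}$ for $x\in X$, $r\in(0,\infty)$. The topology $\mathcal T_\rho$ consists of all sets $G\subset X$ such that for each $x\in G$ there is $r_x\in(0,\infty)$ with $B_\rho(x,r_x)\subset G$. (Balls need not be open, or even Borel, with respect to $\mathcal T_\rho$.) The $\sigma$-algebra generated by $\rho$ is the Borel $\sigma$-algebra of $\mathcal T_\rho$. Homogeneity: given a nonempty set $X$, a quasimetric $\rho$ on $X$, and a Borel measure $\mu$ (Borel with respect to $\mathcal T_\rho$),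 the space $(X,\rho,\mu)$ is homogeneous in the Coifman--Weiss sense if all balls are $\mu$-measurable, $\mu(B_\rho(x,r))\in(0,\infty)$ for all $x \in X$, $r\in(0,\infty)$, and there exists a constant $C\in[1,\infty)$ such that $\mu(B_\rho(x,2r))\le C\mu(B_\rho(x,r))$ for all $x\in X$, $r\in(0,\infty)$. *)

theory Defs
  imports "HOL-Analysis.Analysis" "HOL-Library.Function_Algebras"
begin

quotient_type torus = real / "\<lambda>x y. x - y \<in> \<int>"
proof (rule equivpI)
  show "reflp (\<lambda>x y::real. x - y \<in> \<int>)"
    by (simp add: reflp_def)
  show "symp (\<lambda>x y::real. x - y \<in> \<int>)"
    by (metis (no_types, lifting) sympI minus_diff_eq Ints_minus)
  show "transp (\<lambda>x y::real. x - y \<in> \<int>)"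
  proof (rule transpI)
    fix x y z :: real
    assume "x - y \<in> \<int>" "y - z \<in> \<int>"
    then have "(x - y) + (y - z) \<in> \<int>" by (rule Ints_add)
    then show "x - z \<in> \<int>" by simp
  qed
qed

instantiation torus :: ab_group_add
begin

lift_definition zero_torus :: torus is "0 :: real" .

lift_definition plus_torus :: "torus \<Rightarrow> torus \<Rightarrow> torus" is "(+) :: real \<Rightarrow> real \<Rightarrow> real"
  by (metis Ints_add add_diff_add)

lift_definition uminus_torus :: "torus \<Rightarrow> torus" is "uminus :: real \<Rightarrow> real"
  by (metis Ints_minus minus_diff_minus)

lift_definition minus_torus :: "torus \<Rightarrow> torus \<Rightarrow> torus" is "(-) :: real \<Rightarrow> real \<Rightarrow> real"
proof -
  fix a b c d :: real
  assume "a - b \<in> \<int>" "c - d \<in> \<int>"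
  then have "(a - b) - (c - d) \<in> \<int>" by (rule Ints_diff)
  then show "a - c - (b - d) \<in> \<int>" by (simp add: algebra_simps)
qed

instance
  by standard (transfer; simp)+

end

text \<open>Addition on this type is coordinatewise, by the instances of \<^theory>\<open>HOL-Library.Function_Algebras\<close>.\<close>

type_synonym infinite_torus = "nat \<Rightarrow> torus"

definition quasimetric :: "('a \<Rightarrow> 'a \<Rightarrow> real) \<Rightarrow> bool" where
  "quasimetric \<rho> \<longleftrightarrow>
     (\<forall>x y. 0 \<le> \<rho> x y) \<and>
     (\<forall>x y. \<rho> x y = 0 \<longleftrightarrow> x = y) \<and>
     (\<forall>x y. \<rho> x y = \<rho> y x) \<and>
     (\<exists>K\<ge>1. \<forall>x y z. \<rho> x y \<le> K * (\<rho> x z + \<rho> z y))"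

definition qball :: "('a \<Rightarrow> 'a \<Rightarrow> real) \<Rightarrow> 'a \<Rightarrow> real \<Rightarrow> 'a set" where
  "qball \<rho> x r = {y. \<rho> x y < r}"

definition qtopology :: "('a \<Rightarrow> 'a \<Rightarrow> real) \<Rightarrow> 'a topology" where
  "qtopology \<rho> = topology (\<lambda>G. \<forall>x\<in>G. \<exists>r>0. qball \<rho> x r \<subseteq> G)"

lemma openin_qtopology:
  "openin (qtopology \<rho>) G \<longleftrightarrow> (\<forall>x\<in>G. \<exists>r>0. qball \<rho> x r \<subseteq> G)"
proof -
  have "istopology (\<lambda>G. \<forall>x\<in>G. \<exists>r>0. qball \<rho> x r \<subseteq> G)"
    unfolding istopology_def
  proof (intro conjI allI impI ballI)
    fix S T x
    assume S: "\<forall>x\<in>S. \<exists>r>0. qball \<rho> x r \<subseteq> S" and T: "\<forall>x\<in>T. \<exists>r>0. qball \<rho> x r \<subseteq> T"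
      and x: "x \<in> S \<inter> T"
    obtain r where r: "r > 0" "qball \<rho> x r \<subseteq> S" using S x by blast
    obtain s where s: "s > 0" "qball \<rho> x s \<subseteq> T" using T x by blast
    have "qball \<rho> x (min r s) \<subseteq> S \<inter> T" using r s by (auto simp: qball_def)
    then show "\<exists>t>0. qball \<rho> x t \<subseteq> S \<inter> T" using r s by (intro exI[of _ "min r s"]) simp
  next
    fix \<K> x
    assume "\<forall>K\<in>\<K>. \<forall>x\<in>K. \<exists>r>0. qball \<rho> x r \<subseteq> K" and "x \<in> \<Union>\<K>"
    then show "\<exists>r>0. qball \<rho> x r \<subseteq> \<Union>\<K>" by (meson UnionE Union_upper order_trans)
  qed
  then show ?thesis by (simp add: qtopology_def)
qed

definition qborel :: "('a \<Rightarrow> 'a \<Rightarrow> real) \<Rightarrow> 'a measure" where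
  "qborel \<rho> = sigma UNIV {G. openin (qtopology \<rho>) G}"

text \<open>Measurability of the balls is a genuine requirement, since balls need not be Borel sets
  of the topology of \<open>\<rho>\<close>.\<close>

definition homogeneous :: "('a \<Rightarrow> 'a \<Rightarrow> real) \<Rightarrow> 'a measure \<Rightarrow> bool" where
  "homogeneous \<rho> \<mu> \<longleftrightarrow>
     quasimetric \<rho> \<and>
     sets \<mu> = sets (qborel \<rho>) \<and>
     (\<forall>x. \<forall>r>0. qball \<rho> x r \<in> sets \<mu>) \<and>
     (\<forall>x. \<forall>r>0. 0 < emeasure \<mu> (qball \<rho> x r) \<and> emeasure \<mu> (qball \<rho> x r) < \<infinity>) \<and>
     (\<exists>C::real. C \<ge> 1 \<and>
        (\<forall>x. \<forall>r>0. emeasure \<mu> (qball \<rho> x (2 * r)) \<le> ennreal C * emeasure \<mu> (qball \<rho> x r)))"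

end

theory Submission
  imports Defs
begin

text \<open>
  A doubling measure on a bounded space forces the size of an \<open>R / 2\<^sup>k\<close>-separated set to be at most
  \<open>2 ^ (c * k + b)\<close>. On the other hand, by invariance \<open>x \<mapsto> x + x\<close> is Lipschitz with constant
  \<open>2 * K\<close>, and it is surjective. Hence pulling a separated set back along \<open>x \<mapsto> x + x\<close> preserves
  separation up to that factor, while its size is multiplied by the number of available points of
  order two, once the scale is below the separation of these points. The infinite torus has more
  than any given number of such points, so separated sets grow with an exponent larger than \<open>c\<close>.
\<close>

section \<open>Packing bound from a doubling measure\<close>

definition separated :: "('a \<Rightarrow> 'a \<Rightarrow> real) \<Rightarrow> real \<Rightarrow> 'a set \<Rightarrow> bool" where
  "separated \<rho> e S \<longleftrightarrow> (\<forall>x\<in>S. \<forall>y\<in>S. x \<noteq> y \<longrightarrow> e \<le> \<rho> x y)"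

lemma emeasure_qball_iterate:
  assumes doubling: "\<And>x r. 0 < r \<Longrightarrow>
      emeasure \<mu> (qball \<rho> x (2 * r)) \<le> ennreal C * emeasure \<mu> (qball \<rho> x r)"
    and "1 \<le> C" "0 < r"
  shows "emeasure \<mu> (qball \<rho> x r) \<le> ennreal (C ^ k) * emeasure \<mu> (qball \<rho> x (r / 2 ^ k))"
proof (induction k)
  case (Suc k)
  have "emeasure \<mu> (qball \<rho> x (r / 2 ^ k)) \<le> ennreal C * emeasure \<mu> (qball \<rho> x (r / 2 ^ Suc k))"
    using doubling[of "r / 2 ^ Suc k" x] \<open>0 < r\<close> by simp
  then have "ennreal (C ^ k) * emeasure \<mu> (qball \<rho> x (r / 2 ^ k))
      \<le> ennreal (C ^ k) * (ennreal C * emeasure \<mu> (qball \<rho> x (r / 2 ^ Suc k)))"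
    by (rule mult_left_mono) simp
  also have "\<dots> = ennreal (C ^ Suc k) * emeasure \<mu> (qball \<rho> x (r / 2 ^ Suc k))"
    using \<open>1 \<le> C\<close> by (simp add: ennreal_mult mult_ac)
  finally show ?case using Suc.IH by (rule order_trans[rotated])
qed simp

text \<open>A common point \<open>z\<close> of two balls would, by the quasi-triangle inequality
  through \<open>z\<close>, put their centres at distance less than
  \<open>2 * K * r\<close>.\<close>

lemma disjoint_qballs:
  assumes sym: "\<And>x y. \<rho> x y = \<rho> y x"
    and tri: "\<And>x y z. \<rho> x y \<le> K * (\<rho> x z + \<rho> z y)"
    and "0 < K" "2 * K * r \<le> e" "separated \<rho> e S"
  shows "disjoint_family_on (\<lambda>x. qball \<rho> x r) S"
  unfolding disjoint_family_on_def
proof (intro ballI impI equals0I)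
  fix x y z
  assume xy: "x \<in> S" "y \<in> S" "x \<noteq> y" and z: "z \<in> qball \<rho> x r \<inter> qball \<rho> y r"
  have "\<rho> x y \<le> K * (\<rho> x z + \<rho> z y)" by (rule tri)
  also have "\<dots> < K * (r + r)"
    using z \<open>0 < K\<close> by (intro mult_strict_left_mono add_strict_mono) (auto simp: qball_def sym[of z])
  also have "\<dots> \<le> e" using assms(4) by (simp add: algebra_simps)
  finally show False using xy assms(5) unfolding separated_def by (meson leD)
qed

text \<open>Small balls around the points of \<open>S\<close> are disjoint, and by doubling each
  carries a fixed fraction of the total mass, since the ball of radius \<open>R\<close> is the whole
  space. The exponent is linear in \<open>k\<close>, with \<open>b\<close> and \<open>c\<close>
  independent of \<open>S\<close>.\<close>

lemma homogeneous_card_separated: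
  assumes hom: "homogeneous \<rho> \<mu>" and bounded: "\<And>x y. \<rho> x y < R"
  obtains b c :: nat
  where "\<And>S k. finite S \<Longrightarrow> separated \<rho> (R / 2 ^ k) S \<Longrightarrow> card S \<le> 2 ^ (c * k + b)"
proof -
  have \<rho>: "\<And>x y. 0 \<le> \<rho> x y" "\<And>x y. \<rho> x y = \<rho> y x"
    and meas: "\<And>x r. 0 < r \<Longrightarrow> qball \<rho> x r \<in> sets \<mu>"
    and pos: "\<And>x r. 0 < r \<Longrightarrow> 0 < emeasure \<mu> (qball \<rho> x r)"
    and fin: "\<And>x r. 0 < r \<Longrightarrow> emeasure \<mu> (qball \<rho> x r) < \<infinity>"
    using hom by (auto simp: homogeneous_def quasimetric_def)
  obtain K where K: "1 \<le> K" "\<And>x y z. \<rho> x y \<le> K * (\<rho> x z + \<rho> z y)"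
    using hom by (auto simp: homogeneous_def quasimetric_def)
  obtain C where C: "1 \<le> C" "\<And>x r. 0 < r \<Longrightarrow>
      emeasure \<mu> (qball \<rho> x (2 * r)) \<le> ennreal C * emeasure \<mu> (qball \<rho> x r)"
    using hom unfolding homogeneous_def by blast
  \<comment> \<open>After \<open>m\<close> further halvings of the radius the balls become disjoint;
    \<open>2 ^ c\<close> replaces \<open>C\<close> so that the bound is a power of two.\<close>
  obtain m :: nat where m: "2 * K < 2 ^ m" using real_arch_pow[of 2 "2 * K"] by auto
  obtain c :: nat where c: "C < 2 ^ c" using real_arch_pow[of 2 C] by auto
  have R: "0 < R" using \<rho>(1) bounded by (rule le_less_trans)
  have U: "qball \<rho> x R = UNIV" for x using bounded by (auto simp: qball_def)
  have "card S \<le> 2 ^ (c * k + c * m)" if S: "finite S" "separated \<rho> (R / 2 ^ k) S" for S k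
  proof -
    define r where "r = R / 2 ^ (k + m)"
    have "0 < r" using R by (simp add: r_def)
    have "2 * K * r \<le> 2 ^ m * r" using m \<open>0 < r\<close> by simp
    also have "\<dots> = R / 2 ^ k" by (simp add: r_def power_add)
    finally have disj: "disjoint_family_on (\<lambda>x. qball \<rho> x r) S"
      using disjoint_qballs[OF \<rho>(2) K(2) _ _ S(2)] K(1) by simp
    have "of_nat (card S) * emeasure \<mu> UNIV = (\<Sum>x\<in>S. emeasure \<mu> UNIV)" by simp
    also have "\<dots> \<le> (\<Sum>x\<in>S. ennreal (C ^ (k + m)) * emeasure \<mu> (qball \<rho> x r))"
      using emeasure_qball_iterate[OF C(2,1) R, where k = "k + m"] by (intro sum_mono) (simp add: U r_def)
    also have "\<dots> = ennreal (C ^ (k + m)) * (\<Sum>x\<in>S. emeasure \<mu> (qball \<rho> x r))"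
      by (simp add: sum_distrib_left)
    also have "(\<Sum>x\<in>S. emeasure \<mu> (qball \<rho> x r)) = emeasure \<mu> (\<Union>x\<in>S. qball \<rho> x r)"
      using meas \<open>0 < r\<close> disj S(1) by (intro sum_emeasure) auto
    also have "ennreal (C ^ (k + m)) * \<dots> \<le> ennreal (C ^ (k + m)) * emeasure \<mu> UNIV"
      using meas[OF R] U by (intro mult_left_mono emeasure_mono) auto
    finally have "ennreal (real (card S)) * emeasure \<mu> UNIV \<le> ennreal (C ^ (k + m)) * emeasure \<mu> UNIV"
      by (simp add: ennreal_of_nat_eq_real_of_nat)
    \<comment> \<open>The total mass is that of a ball of radius \<open>R\<close>; being positive
      and finite, it can be cancelled.\<close>
    moreover have "0 < emeasure \<mu> UNIV" "emeasure \<mu> UNIV < \<infinity>"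
      using pos[OF R] fin[OF R] U by simp_all
    ultimately have "ennreal (real (card S)) \<le> ennreal (C ^ (k + m))"
      by (metis ennreal_mult_le_mult_iff infinity_ennreal_def less_irrefl mult.commute)
    then have "real (card S) \<le> C ^ (k + m)" using C(1) by simp
    also have "\<dots> \<le> (2 ^ c) ^ (k + m)" using c C(1) by (intro power_mono) auto
    also have "\<dots> = real (2 ^ (c * k + c * m))" by (simp add: power_mult[symmetric] distrib_left)
    finally show ?thesis by (simp only: of_nat_le_iff)
  qed
  then show thesis by (rule that)
qed

section \<open>Growth of separated sets under halving\<close>

lemma invariant_double_le:
  fixes \<rho> :: "'a::ab_group_add \<Rightarrow> 'a \<Rightarrow> real"
  assumes tri: "\<And>x y z. \<rho> x y \<le> K * (\<rho> x z + \<rho> z y)"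
    and inv: "\<And>x y z. \<rho> (x + z) (y + z) = \<rho> x y"
  shows "\<rho> (x + x) (y + y) \<le> 2 * K * \<rho> x y"
  \<comment> \<open>Both legs of the path through \<open>y + x\<close> are translates of the pair
    \<open>x\<close>, \<open>y\<close>.\<close>
  using tri[of "x + x" "y + y" "y + x"] inv[of x x y] inv[of x y y] by (simp add: add.commute)

text \<open>\<open>T\<close> consists of the halves \<open>h s + v\<close> of the points of
  \<open>S\<close>. Halves of distinct points stay apart because doubling is Lipschitz with constant
  \<open>2 * K\<close>; halves of the same point are translates of elements of \<open>V\<close>,
  hence at least \<open>d\<close> apart.\<close>

lemma separated_pullback_double:
  fixes \<rho> :: "'a::ab_group_add \<Rightarrow> 'a \<Rightarrow> real"
  assumes nonneg: "\<And>x y. 0 \<le> \<rho> x y"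
    and tri: "\<And>x y z. \<rho> x y \<le> K * (\<rho> x z + \<rho> z y)"
    and inv: "\<And>x y z. \<rho> (x + z) (y + z) = \<rho> x y"
    and L: "2 * K \<le> L" "1 \<le> L"
    and divisible: "\<And>x::'a. \<exists>h. h + h = x"
    and V: "\<And>v. v \<in> V \<Longrightarrow> v + v = 0" "separated \<rho> d V"
    and S: "separated \<rho> e S" and e: "e \<le> d" "0 \<le> d"
  obtains T where "card T = card S * card V" "separated \<rho> (e / L) T"
    "finite S \<Longrightarrow> finite V \<Longrightarrow> finite T"
proof -
  obtain h where h: "\<And>x::'a. h x + h x = x" using divisible by metis
  let ?f = "\<lambda>(s, v). h s + v"
  have double: "(h s + v) + (h s + v) = s" if "v \<in> V" for s v
  proof -
    have "(h s + v) + (h s + v) = (h s + h s) + (v + v)" by (simp only: ac_simps)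
    then show ?thesis using h V(1) that by simp
  qed
  have inj: "inj_on ?f (S \<times> V)"
  proof (rule inj_onI, clarsimp)
    fix s v t w
    assume vw: "v \<in> V" "w \<in> V" and eq: "h s + v = h t + w"
    then have "s = t" using double by metis
    then show "s = t \<and> v = w" using eq by simp
  qed
  have "e / L \<le> \<rho> (h s + v) (h t + w)"
    if "s \<in> S" "t \<in> S" "v \<in> V" "w \<in> V" "h s + v \<noteq> h t + w" for s t v w
  proof (cases "s = t")
    case True
    have "e / L \<le> d / L" using e L by (intro divide_right_mono) auto
    also have "\<dots> \<le> d" using e(2) L by (simp add: divide_le_eq mult_le_cancel_left1)
    also have "\<dots> \<le> \<rho> v w" using V(2) that True by (auto simp: separated_def)
    also have "\<dots> = \<rho> (h s + v) (h t + w)" using inv[of v "h s" w] True by (simp add: add.commute)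
    finally show ?thesis .
  next
    case False
    have "e \<le> \<rho> s t" using S that False by (auto simp: separated_def)
    also have "\<dots> \<le> 2 * K * \<rho> (h s + v) (h t + w)"
      using invariant_double_le[OF tri inv, of "h s + v" "h t + w"] double that by simp
    also have "\<dots> \<le> L * \<rho> (h s + v) (h t + w)" using L nonneg by (intro mult_right_mono) auto
    finally show ?thesis using L by (simp add: divide_le_eq mult.commute)
  qed
  then have "separated \<rho> (e / L) (?f ` (S \<times> V))" by (auto simp: separated_def)
  moreover have "card (?f ` (S \<times> V)) = card S * card V"
    using card_image[OF inj] by (simp add: card_cartesian_product)
  ultimately show thesis using that by blast
qed

lemma exists_separated_card_power:
  fixes \<rho> :: "'a::ab_group_add \<Rightarrow> 'a \<Rightarrow> real"
  assumes nonneg: "\<And>x y. 0 \<le> \<rho> x y"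
    and tri: "\<And>x y z. \<rho> x y \<le> K * (\<rho> x z + \<rho> z y)"
    and inv: "\<And>x y z. \<rho> (x + z) (y + z) = \<rho> x y"
    and L: "2 * K \<le> L" "1 \<le> L"
    and divisible: "\<And>x::'a. \<exists>h. h + h = x"
    and V: "finite V" "\<And>v. v \<in> V \<Longrightarrow> v + v = 0" "separated \<rho> d V" "0 \<le> d"
  shows "\<exists>S. finite S \<and> card S = card V ^ j \<and> separated \<rho> (d / L ^ j) S"
proof (induction j)
  case 0
  \<comment> \<open>A singleton is separated at every scale.\<close>
  show ?case by (rule exI[of _ "{0}"]) (simp add: separated_def)
next
  case (Suc j)
  then obtain S where S: "finite S" "card S = card V ^ j" "separated \<rho> (d / L ^ j) S" by blast
  \<comment> \<open>The scale only shrinks, so it stays below the separation \<open>d\<close> of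
    \<open>V\<close>, as the pullback requires.\<close>
  have "d / L ^ j \<le> d"
    using L V(4) one_le_power[OF L(2), of j] by (simp add: divide_le_eq mult_le_cancel_left1)
  from separated_pullback_double[of \<rho>, OF nonneg tri inv L divisible V(2,3) S(3) this V(4)]
  obtain T where "card T = card S * card V" "separated \<rho> (d / L ^ j / L) T"
    "finite S \<Longrightarrow> finite V \<Longrightarrow> finite T"
    by blast
  then show ?case using S V(1) by (auto simp: mult.commute intro!: exI[of _ T])
qed

lemma finite_separated:
  assumes pos: "\<And>x y. x \<noteq> y \<Longrightarrow> 0 < \<rho> x y" and "finite V" "0 < R"
  obtains q :: nat where "separated \<rho> (R / 2 ^ q) V"
proof -
  \<comment> \<open>The inserted 1 keeps the minimum defined when \<open>V\<close> has at most one
    point.\<close>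
  define d where "d = Min (insert 1 ((\<lambda>(x, y). \<rho> x y) ` {(x, y) \<in> V \<times> V. x \<noteq> y}))"
  have fin: "finite ((\<lambda>(x, y). \<rho> x y) ` {(x, y) \<in> V \<times> V. x \<noteq> y})"
    using finite_subset[of "{(x, y) \<in> V \<times> V. x \<noteq> y}" "V \<times> V"] \<open>finite V\<close> by auto
  have "0 < d" using fin pos by (auto simp: d_def)
  have d: "d \<le> \<rho> x y" if "x \<in> V" "y \<in> V" "x \<noteq> y" for x y
    unfolding d_def using fin that by (intro Min_le) auto
  obtain q :: nat where "R / d < 2 ^ q" using real_arch_pow[of 2 "R / d"] by auto
  then have "R / 2 ^ q \<le> d" using \<open>0 < d\<close> by (simp add: field_simps)
  then have "separated \<rho> (R / 2 ^ q) V" unfolding separated_def using d by (meson order_trans)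
  then show thesis by (rule that)
qed

text \<open>A pullback costs at most \<open>m\<close> halvings of the scale, for which the packing
  bound allows a factor \<open>2 ^ (c * m)\<close>. Taking \<open>2 ^ (c * m + 1)\<close>
  involutions gains an extra factor 2 each time, which finally beats the fixed offset coming from
  \<open>b\<close> and the initial scale \<open>q\<close>.\<close>

lemma not_homogeneous_of_many_involutions:
  fixes \<rho> :: "'a::ab_group_add \<Rightarrow> 'a \<Rightarrow> real"
  assumes bounded: "\<And>x y. \<rho> x y < R"
    and inv: "\<And>x y z. \<rho> (x + z) (y + z) = \<rho> x y"
    and divisible: "\<And>x::'a. \<exists>h. h + h = x"
    and involutions: "\<And>n::nat. \<exists>V::'a set. finite V \<and> card V = 2 ^ n \<and> (\<forall>v\<in>V. v + v = 0)"
  shows "\<not> homogeneous \<rho> \<mu>"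
proof
  assume hom: "homogeneous \<rho> \<mu>"
  then have \<rho>: "\<And>x y. 0 \<le> \<rho> x y" "\<And>x y. \<rho> x y = 0 \<longleftrightarrow> x = y"
    by (auto simp: homogeneous_def quasimetric_def)
  obtain K where K: "1 \<le> K" "\<And>x y z. \<rho> x y \<le> K * (\<rho> x z + \<rho> z y)"
    using hom by (auto simp: homogeneous_def quasimetric_def)
  obtain m :: nat where m: "2 * K < 2 ^ m" using real_arch_pow[of 2 "2 * K"] by auto
  obtain b c :: nat
    where card: "\<And>S k. finite S \<Longrightarrow> separated \<rho> (R / 2 ^ k) S \<Longrightarrow> card S \<le> 2 ^ (c * k + b)"
    using homogeneous_card_separated[OF hom bounded] by blast
  have R: "0 < R" using \<rho>(1) bounded by (rule le_less_trans)
  obtain V :: "'a set"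
    where V: "finite V" "card V = 2 ^ (c * m + 1)" "\<And>v. v \<in> V \<Longrightarrow> v + v = 0"
    using involutions by metis
  have pos: "0 < \<rho> x y" if "x \<noteq> y" for x y using \<rho> that by (metis less_eq_real_def)
  obtain q where q: "separated \<rho> (R / 2 ^ q) V" using finite_separated[of \<rho>, OF pos V(1) R] by blast
  \<comment> \<open>The packing bound after \<open>j\<close> pullbacks reduces to
    \<open>j \<le> c * q + b\<close>; this is the first \<open>j\<close> violating it.\<close>
  define j where "j = c * q + b + 1"
  obtain S where S: "finite S" "card S = card V ^ j" "separated \<rho> (R / 2 ^ q / (2 ^ m) ^ j) S"
    using exists_separated_card_power[OF \<rho>(1) K(2) inv _ _ divisible V(1,3) q, of "2 ^ m" j] m R
    by auto
  have "R / 2 ^ q / (2 ^ m) ^ j = R / 2 ^ (q + m * j)" by (simp add: power_add power_mult)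
  then have "(2::nat) ^ ((c * m + 1) * j) \<le> 2 ^ (c * (q + m * j) + b)"
    using card[OF S(1), of "q + m * j"] S(2,3) V(2) by (simp only: power_mult)
  then have "(c * m + 1) * j \<le> c * (q + m * j) + b" by (rule power_le_imp_le_exp[rotated]) simp
  then show False by (simp add: j_def algebra_simps)
qed

section \<open>Divisibility and involutions in the infinite torus\<close>

lemma torus_divisible_two: "\<exists>h::torus. h + h = x"
proof (transfer)
  fix x :: real
  show "\<exists>h. h + h - x \<in> \<int>" by (rule exI[of _ "x / 2"]) simp
qed

lemma torus_involution: obtains a :: torus where "a \<noteq> 0" "a + a = 0"
proof -
  have "\<exists>a::torus. a \<noteq> 0 \<and> a + a = 0"
  proof (transfer)
    have "(1 / 2 :: real) \<notin> \<int>" by (auto elim!: Ints_cases simp: field_simps)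
    then show "\<exists>a::real. \<not> a - 0 \<in> \<int> \<and> a + a - 0 \<in> \<int>" by (intro exI[of _ "1 / 2"]) simp
  qed
  then show thesis using that by blast
qed

lemma infinite_torus_divisible_two: "\<exists>h::infinite_torus. h + h = x"
proof -
  obtain f where "\<And>y::torus. f y + f y = y" using torus_divisible_two by metis
  then show ?thesis by (intro exI[of _ "f \<circ> x"]) (simp add: fun_eq_iff)
qed

lemma infinite_torus_involutions:
  "\<exists>V::infinite_torus set. finite V \<and> card V = 2 ^ n \<and> (\<forall>v\<in>V. v + v = 0)"
proof -
  obtain a :: torus where a: "a \<noteq> 0" "a + a = 0" by (rule torus_involution)
  \<comment> \<open>\<open>g\<close> embeds the subsets of the coordinates into the points killed by
    doubling; the subsets of the first \<open>n\<close> coordinates give \<open>2 ^ n\<close> of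
    them.\<close>
  define g :: "nat set \<Rightarrow> infinite_torus" where "g A = (\<lambda>i. if i \<in> A then a else 0)" for A
  have "inj g" using a(1) by (auto simp: inj_def g_def fun_eq_iff split: if_splits)
  then have "card (g ` Pow {..<n}) = 2 ^ n"
    by (simp add: card_image[OF inj_on_subset[OF _ subset_UNIV]] card_Pow)
  moreover have "g A + g A = 0" for A using a(2) by (simp add: g_def fun_eq_iff)
  ultimately show ?thesis by (intro exI[of _ "g ` Pow {..<n}"]) auto
qed

theorem theorem1p3:
  fixes \<rho> :: "infinite_torus \<Rightarrow> infinite_torus \<Rightarrow> real"
  assumes "quasimetric \<rho>"
    and "bdd_above (range (\<lambda>(x, y). \<rho> x y))"
    and "\<And>x y z. \<rho> (x + z) (y + z) = \<rho> x y"
  shows "\<not> (\<exists>\<mu>. homogeneous \<rho> \<mu>)"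
proof -
  obtain M where "\<And>x y. \<rho> x y \<le> M" using assms(2) by (auto simp: bdd_above_def)
  \<comment> \<open>Adding 1 makes the bound strict, so that one open ball is the whole
    space.\<close>
  then have bounded: "\<rho> x y < M + 1" for x y by (smt (verit))
  show ?thesis
    using not_homogeneous_of_many_involutions[of \<rho>, OF bounded assms(3) infinite_torus_divisible_two
        infinite_torus_involutions] by blast
qed

end
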